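(* Let $\sigma\in\mathcal K$. Then there exists a function $\mu^{(\sigma)}\in\mathcal M$ such that $$\mu^{(\sigma)}_t\to\mu^{(\sigma)}\ \text{ a.e. in }\Omega\text{ as }t\to\infty,$$ $$\|\mu^{(\sigma)}_t\|_{L^1(\Omega)}\to\|\mu^{(\sigma)}\|_{L^1(\Omega)}\ \text{ as }t\to\infty,$$ $$\text{for every } t\in\mathbb N,\quad \mu^{(\sigma)}_t\leqslant\mu^{(\sigma)}\ \text{ a.e. in }\Omega.$$
   Context: Here $\mathbb N=\{1,2,\dots\}$, $n\in\mathbb N$, $n\geqslant 2$, $\Omega$ is a bounded domain (nonempty open connected set) of $\mathbb R^n$, and $|\cdot|$ is the Euclidean norm. For $y\in\mathbb R^n$, $\rho>0$ let $B(y,\rho)=\{x\in\mathbb R^n:|x-y|<\rho\}$; for $y\in\mathbb R^n$, $t\in\mathbb N$ let $Q_t(y)=\{x\in\mathbb R^n:|x_i-y_i|<\frac1{2t},\ i=1,\dots,n\}$. Let $Y_t=\{y\in\mathbb R^n: t y_i\in\mathbb Z,\ i=1,\dots,n\}$ and $X_t=\{y\in Y_t: Q_t(y)\subset\Omega\}$. A number $m\in\mathbb N$ is fixed such that $X_t\neq\emptyset$ for every $t\in\mathbb N$, $t>m$ (such $m$ exists). For $t>m$ let $G_t=\bigcup_{y\in X_t}B(y,\frac1{2t})\subset\Omega$, let $\chi_t:\Omega\to\mathbb R$ be the characteristic function of $G_t$ and, for $y\in X_t$, let $\chi_{t,y}:\Omega\to\mathbb R$ be the characteristic function of $B(y,\frac1{2t})$.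 $\mathcal K$ is the set of all functions $\sigma:[0,+\infty)\to(0,+\infty)$ such that: (i) $\sigma$ is continuous in $(0,+\infty)$; (ii) $\sigma\geqslant1$ in $[0,1]$; (iii) $\sigma(\rho)\to+\infty$ as $\rho>0$, $\rho\to0$; (iv) $\int_0^1\sigma(\rho)\rho^{n-1}d\rho<+\infty$. For $\sigma\in\mathcal K$ and $t\in\mathbb N$, $t>m$, the function $\nu_t^{(\sigma)}:\Omega\to\mathbb R$ is defined by $\nu_t^{(\sigma)}(x)=\sigma(1)(1-\chi_t(x))+\sum_{y\in X_t}\sigma(2t|x-y|)\chi_{t,y}(x)$. For $\sigma\in\mathcal K$ and $t\in\mathbb N$, $\mu_t^{(\sigma)}=\sum_{k=1}^t k^{-2}\nu_{m+k}^{(\sigma)}$. $\mathcal M$ is the set of all functions $\mu:\Omega\to\mathbb R$, $\mu\in L^1(\Omega)$, such that: (i) $\mu\geqslant1$ in $\Omega$; (ii) for every nonempty open set $G\subset\Omega$ and every $C>0$ there exists a measurable set $H\subset G$ with $\mathrm{meas}\,H>0$ and $\mu\geqslant C$ in $H$. Here $\mathrm{meas}$ is the $n$-dimensional Lebesgue measure. *)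

theory Defs
  imports "HOL-Analysis.Analysis"
begin

text \<open>
  Functions on \<open>\<Omega>\<close> or on \<open>[0, \<infinity>)\<close> are total functions; their values outside these sets are
  irrelevant. The parameter \<open>t\<close> always satisfies \<open>t \<ge> 1\<close> where the definitions are used.
\<close>

definition Q :: "nat \<Rightarrow> real ^ 'n \<Rightarrow> (real ^ 'n) set" where
  "Q t y = {x. \<forall>i. \<bar>x $ i - y $ i\<bar> < 1 / (2 * real t)}"

definition Y :: "nat \<Rightarrow> (real ^ 'n) set" where
  "Y t = {y. \<forall>i. real t * y $ i \<in> \<int>}"

definition X :: "(real ^ 'n) set \<Rightarrow> nat \<Rightarrow> (real ^ 'n) set" where
  "X \<Omega> t = {y \<in> Y t. Q t y \<subseteq> \<Omega>}"

definition G :: "(real ^ 'n) set \<Rightarrow> nat \<Rightarrow> (real ^ 'n) set" where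
  "G \<Omega> t = (\<Union>y\<in>X \<Omega> t. ball y (1 / (2 * real t)))"

definition K_class :: "nat \<Rightarrow> (real \<Rightarrow> real) set" where
  "K_class n = {\<sigma>.
     (\<forall>\<rho>\<ge>0. \<sigma> \<rho> > 0) \<and>
     continuous_on {0<..} \<sigma> \<and>
     (\<forall>\<rho>\<in>{0..1}. \<sigma> \<rho> \<ge> 1) \<and>
     filterlim \<sigma> at_top (at_right 0) \<and>
     set_integrable lborel {0..1} (\<lambda>\<rho>. \<sigma> \<rho> * \<rho> ^ (n - 1))}"

text \<open>For bounded \<open>\<Omega>\<close> and \<open>t \<ge> 1\<close> the index set \<open>X \<Omega> t\<close> is finite, so the sum is a genuine one.\<close>

definition nu :: "(real ^ 'n) set \<Rightarrow> (real \<Rightarrow> real) \<Rightarrow> nat \<Rightarrow> real ^ 'n \<Rightarrow> real" where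
  "nu \<Omega> \<sigma> t x =
     \<sigma> 1 * (1 - indicat_real (G \<Omega> t) x) +
     (\<Sum>y\<in>X \<Omega> t. \<sigma> (2 * real t * norm (x - y)) * indicat_real (ball y (1 / (2 * real t))) x)"

definition mu :: "(real ^ 'n) set \<Rightarrow> nat \<Rightarrow> (real \<Rightarrow> real) \<Rightarrow> nat \<Rightarrow> real ^ 'n \<Rightarrow> real" where
  "mu \<Omega> m \<sigma> t x = (\<Sum>k=1..t. 1 / (real k)\<^sup>2 * nu \<Omega> \<sigma> (m + k) x)"

definition M_class :: "(real ^ 'n) set \<Rightarrow> (real ^ 'n \<Rightarrow> real) set" where
  "M_class \<Omega> = {\<mu>.
     integrable (lebesgue_on \<Omega>) \<mu> \<and>
     (\<forall>x\<in>\<Omega>. \<mu> x \<ge> 1) \<and>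
     (\<forall>U C. open U \<and> U \<noteq> {} \<and> U \<subseteq> \<Omega> \<and> C > 0 \<longrightarrow>
        (\<exists>H. H \<in> sets lebesgue \<and> H \<subseteq> U \<and> emeasure lebesgue H > 0 \<and> (\<forall>x\<in>H. \<mu> x \<ge> C)))}"

text \<open>Meaningful for functions integrable on \<open>\<Omega>\<close>; the Bochner integral is 0 otherwise.\<close>

definition L1_norm :: "(real ^ 'n) set \<Rightarrow> (real ^ 'n \<Rightarrow> real) \<Rightarrow> real" where
  "L1_norm \<Omega> f = (\<integral>x. \<bar>f x\<bar> \<partial>lebesgue_on \<Omega>)"

end

theory Submission imports Defs begin

text \<open>
  The balls of radius \<open>1/(2t)\<close> around the points of \<open>X \<Omega> t\<close> are disjoint and lie in \<open>\<Omega>\<close>. In polar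
  coordinates the integral of \<open>\<sigma>(2t\<bar>x - y\<bar>)\<close> over such a ball is the volume of the ball times
  \<open>J = n \<integral>\<^bsub>0\<^esub>\<^bsup>1\<^esup> \<sigma>(\<rho>) \<rho>\<^bsup>n-1\<^esup> d\<rho>\<close>, so the integral of \<open>\<nu>\<^sub>t\<close> is at most \<open>(\<sigma>(1) + J) meas \<Omega>\<close>,
  uniformly in \<open>t\<close>. As \<open>\<Sum> k\<^bsup>-2\<^esup>\<close> converges, monotone convergence makes the nonnegative series
  \<open>\<Sum> k\<^bsup>-2\<^esup> \<nu>\<^bsub>m+k\<^esub>\<close> converge almost everywhere to an integrable function. That function is large near
  every grid point, because \<open>\<sigma>\<close> blows up at \<open>0\<close>, and every open set contains a grid cube
  \<open>Q t y\<close> once \<open>t\<close> is large.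
\<close>

section \<open>Integration of radial functions over a ball\<close>

text \<open>
  The library has no integration in polar coordinates; the radial case follows by comparing
  the volumes of the sets \<open>{x \<in> ball y r. norm (x - y) / r > s}\<close>.
\<close>

lemma distr_norm_ball:
  fixes y :: "'a::euclidean_space"
  assumes r: "r > 0"
  shows "distr (density lborel (indicator (ball y r))) borel (\<lambda>x. norm (x - y) / r) =
    density lborel (\<lambda>\<rho>. ennreal (unit_ball_vol DIM('a) * r ^ DIM('a) * (DIM('a) * \<rho> ^ (DIM('a) - 1))) *
      indicator {0..1} \<rho>)"
    (is "?M = ?N")
\<comment> \<open>Two Borel measures on the line that are finite and equal on all rays
  \<open>{s<..}\<close> coincide.\<close>
proof (rule measure_eqI_lessThan)
  define d where "d = DIM('a)"
  define c where "c = unit_ball_vol (real d) * r ^ d"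
  have c: "c \<ge> 0" using r by (simp add: c_def)
  show "sets ?M = sets borel" "sets ?N = sets borel" by auto
  have M: "emeasure ?M {s<..} = emeasure lborel (ball y r \<inter> {x. norm (x - y) / r > s})" for s
  proof -
    have [measurable]: "ball y r \<in> sets borel" by simp
    have *: "{x. norm (x - y) / r > s} \<in> sets borel" by measurable
    have "emeasure ?M {s<..} = emeasure (density lborel (indicator (ball y r))) {x. norm (x - y) / r > s}"
      by (subst emeasure_distr) (auto simp: vimage_def)
    also have "\<dots> = (\<integral>\<^sup>+x. indicator (ball y r) x * indicator {x. norm (x - y) / r > s} x \<partial>lborel)"
      using * by (intro emeasure_density) auto
    also have "\<dots> = emeasure lborel (ball y r \<inter> {x. norm (x - y) / r > s})"
      unfolding indicator_inter_arith[symmetric] using * by (intro nn_integral_indicator) auto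
    finally show ?thesis .
  qed
  have N: "emeasure ?N {s<..} = (\<integral>\<^sup>+\<rho>. ennreal (c * (d * \<rho> ^ (d - 1))) * indicator ({0..1} \<inter> {s<..}) \<rho> \<partial>lborel)" for s
    by (subst emeasure_density) (auto intro!: nn_integral_cong simp: indicator_def c_def d_def)
  show "emeasure ?M {s<..} = emeasure ?N {s<..}" for s
  proof (cases "s \<le> 1")
    case False
    then have "ball y r \<inter> {x. norm (x - y) / r > s} = {}" "{0..1} \<inter> {s<..} = {}"
      using r by (auto simp: dist_norm norm_minus_commute field_simps)
        (smt (verit) mult_less_cancel_left2 mult.commute)
    then show ?thesis unfolding M N by simp
  next
    case True
    \<comment> \<open>Both measures live on \<open>{0..1}\<close>, so a negative threshold acts like
      0, up to null sets.\<close>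
    define a where "a = max 0 s"
    have a: "0 \<le> a" "a \<le> 1" using True by (auto simp: a_def)
    have "emeasure ?N {s<..} = (\<integral>\<^sup>+\<rho>. ennreal (c * (d * \<rho> ^ (d - 1))) * indicator {a..1} \<rho> \<partial>lborel)"
      \<comment> \<open>The sets \<open>{0..1} \<inter> {s<..}\<close> and \<open>{a..1}\<close>
        differ at most in the point \<open>a\<close>.\<close>
      unfolding N
      by (rule nn_integral_cong_AE, rule AE_mp[OF AE_lborel_singleton[of a]])
        (auto simp: indicator_def a_def)
    also have "\<dots> = ennreal (c * 1 ^ d - c * a ^ d)"
      using a c by (intro nn_integral_FTC_Icc) (auto intro!: derivative_eq_intros)
    finally have RN: "emeasure ?N {s<..} = ennreal (c - c * a ^ d)" by simp
    have "emeasure ?M {s<..} = emeasure lborel (ball y r - cball y (a * r))"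
    proof (cases "s < 0")
      case True
      then have "ball y r \<inter> {x. norm (x - y) / r > s} = ball y r" using r
        by auto (smt (verit) divide_nonneg_pos norm_ge_zero)
      \<comment> \<open>Here \<open>a = 0\<close>, and the closed ball that is removed is the single
        point \<open>y\<close>.\<close>
      moreover have "emeasure lborel (ball y r - cball y (a * r)) = emeasure lborel (ball y r)"
        using True emeasure_Diff_null_set[of "{y}" lborel "ball y r"]
        by (simp add: a_def finite_imp_null_set_lborel)
      ultimately show ?thesis unfolding M by simp
    next
      case False
      then show ?thesis unfolding M using r
        by (intro arg_cong[where f="emeasure lborel"])
          (auto simp: a_def dist_norm norm_minus_commute field_simps)
    qed
    also have "\<dots> = emeasure lborel (ball y r) - emeasure lborel (cball y (a * r) \<inter> ball y r)"
    proof -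
      have "emeasure lborel (cball y (a * r) \<inter> ball y r) \<le> emeasure lborel (ball y r)"
        by (intro emeasure_mono) auto
      also have "\<dots> < \<infinity>" using r by (simp add: emeasure_ball)
      finally have "emeasure lborel (ball y r - (cball y (a * r) \<inter> ball y r)) =
          emeasure lborel (ball y r) - emeasure lborel (cball y (a * r) \<inter> ball y r)"
        by (intro emeasure_Diff) auto
      moreover have "ball y r - (cball y (a * r) \<inter> ball y r) = ball y r - cball y (a * r)" by auto
      ultimately show ?thesis by simp
    qed
    \<comment> \<open>The intersection matters only for \<open>a = 1\<close>, where the closed ball
      sticks out of the open one by its sphere.\<close>
    also have "emeasure lborel (cball y (a * r) \<inter> ball y r) = ennreal (c * a ^ d)"
    proof (cases "a = 1")
      case True
      then show ?thesis using r by (simp add: emeasure_ball c_def d_def Int_absorb1 ball_subset_cball)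
    next
      case False
      then have "cball y (a * r) \<inter> ball y r = cball y (a * r)" using a r by auto
         (metis (no_types, opaque_lifting) dual_order.strict_trans1 less_eq_real_def mult_less_cancel_right2 not_less)
      then show ?thesis using a r by (simp add: emeasure_cball c_def d_def power_mult_distrib mult_ac)
    qed
    also have "emeasure lborel (ball y r) = ennreal c"
      using r by (simp add: emeasure_ball c_def d_def)
    also have "ennreal c - ennreal (c * a ^ d) = ennreal (c - c * a ^ d)"
      using a c by (simp add: ennreal_minus)
    finally show ?thesis using RN by simp
  qed
  show "emeasure ?M {s<..} < \<infinity>" for s
  proof -
    have "emeasure ?M {s<..} \<le> emeasure lborel (ball y r)"
      unfolding M by (intro emeasure_mono) auto
    also have "\<dots> < \<infinity>" using r by (simp add: emeasure_ball)
    finally show ?thesis .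
  qed
qed

text \<open>Change of variables along \<open>distr_norm_ball\<close>. The constant factor of the
  image density is the volume of the ball, so the remaining integral depends on neither
  \<open>y\<close> nor \<open>r\<close>; this is the source of bounds uniform in
  \<open>t\<close>.\<close>

lemma nn_integral_ball_radial:
  fixes y :: "'a::euclidean_space" and f :: "real \<Rightarrow> ennreal"
  assumes r: "r > 0" and [measurable]: "f \<in> borel_measurable borel"
  shows "(\<integral>\<^sup>+x. f (norm (x - y) / r) * indicator (ball y r) x \<partial>lborel) =
    emeasure lborel (ball y r) *
      (\<integral>\<^sup>+\<rho>. f \<rho> * ennreal (DIM('a) * \<rho> ^ (DIM('a) - 1)) * indicator {0..1} \<rho> \<partial>lborel)"
proof -
  have [measurable]: "ball y r \<in> sets borel" by simp
  have "(\<integral>\<^sup>+x. f (norm (x - y) / r) * indicator (ball y r) x \<partial>lborel) =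
      (\<integral>\<^sup>+\<rho>. f \<rho> \<partial>distr (density lborel (indicator (ball y r))) borel (\<lambda>x. norm (x - y) / r))"
    by (subst nn_integral_distr) (simp_all add: nn_integral_density mult.commute)
  also have "\<dots> = (\<integral>\<^sup>+\<rho>. emeasure lborel (ball y r) *
      (f \<rho> * ennreal (DIM('a) * \<rho> ^ (DIM('a) - 1)) * indicator {0..1} \<rho>) \<partial>lborel)"
    unfolding distr_norm_ball[OF r] using r
    by (subst nn_integral_density)
      (auto intro!: nn_integral_cong simp: indicator_def emeasure_ball ennreal_mult mult_ac)
  also have "\<dots> = emeasure lborel (ball y r) *
      (\<integral>\<^sup>+\<rho>. f \<rho> * ennreal (DIM('a) * \<rho> ^ (DIM('a) - 1)) * indicator {0..1} \<rho> \<partial>lborel)"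
    by (rule nn_integral_cmult) measurable
  finally show ?thesis .
qed

section \<open>Almost everywhere convergence of a nonnegative series\<close>

text \<open>By monotone convergence the \<open>ennreal\<close>-valued sum has a finite integral,
  hence is finite almost everywhere. This supplies the pointwise summability that
  \<open>integrable_suminf\<close> and \<open>sums_integral\<close> require.\<close>

lemma AE_summable_if_summable_integral:
  fixes f :: "nat \<Rightarrow> 'a \<Rightarrow> real"
  assumes f: "\<And>i. integrable M (f i)" and nn: "\<And>i x. x \<in> space M \<Longrightarrow> 0 \<le> f i x"
    and s: "summable (\<lambda>i. \<integral>x. f i x \<partial>M)"
  shows "AE x in M. summable (\<lambda>i. f i x)"
proof -
  have "(\<integral>\<^sup>+x. (\<Sum>i. ennreal (f i x)) \<partial>M) = (\<Sum>i. \<integral>\<^sup>+x. ennreal (f i x) \<partial>M)"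
    using f by (intro nn_integral_suminf) auto
  also have "\<dots> = (\<Sum>i. ennreal (\<integral>x. f i x \<partial>M))"
    using f nn by (intro suminf_cong nn_integral_eq_integral) auto
  also have "\<dots> \<noteq> \<infinity>"
    using s nn by (simp add: ennreal_suminf_neq_top integral_nonneg_AE)
  finally have "AE x in M. (\<Sum>i. ennreal (f i x)) \<noteq> \<infinity>"
    using f by (intro nn_integral_PInf_AE) auto
  then show ?thesis
  proof (rule AE_mp, intro AE_I2 impI)
    fix x assume "x \<in> space M" "(\<Sum>i. ennreal (f i x)) \<noteq> \<infinity>"
    then show "summable (\<lambda>i. f i x)" using nn by (intro summable_suminf_not_top) auto
  qed
qed

section \<open>Geometry of the grid: disjointness, total volume, finiteness\<close>

text \<open>A common point puts the centres at distance less than \<open>1 / t\<close>; then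
  \<open>t * y $ i\<close> and \<open>t * z $ i\<close> are integers less than 1 apart, hence
  equal.\<close>

lemma disjoint_balls_Y:
  fixes y z :: "real ^ 'n"
  assumes "y \<in> Y t" "z \<in> Y t" "t > 0" "y \<noteq> z"
  shows "ball y (1 / (2 * real t)) \<inter> ball z (1 / (2 * real t)) = {}"
proof (rule ccontr)
  assume "\<not> ?thesis"
  then obtain x where "dist y x < 1 / (2 * real t)" "dist z x < 1 / (2 * real t)" by auto
  then have yz: "dist y z < 1 / real t"
    using dist_triangle_half_l[of y x "1 / real t" z] by (simp add: dist_commute field_simps)
  have "y $ i = z $ i" for i
  proof -
    have "\<bar>y $ i - z $ i\<bar> < 1 / real t"
      using yz component_le_norm_cart[of "y - z" i] by (simp add: dist_norm)
    then have "\<bar>real t * y $ i - real t * z $ i\<bar> < 1"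
      using \<open>t > 0\<close> by (simp add: abs_mult pos_less_divide_eq mult.commute flip: right_diff_distrib)
    moreover have "real t * y $ i - real t * z $ i \<in> \<int>" using assms by (auto simp: Y_def)
    ultimately have "real t * y $ i - real t * z $ i = 0" by (metis Ints_nonzero_abs_less1)
    then show ?thesis using \<open>t > 0\<close> by simp
  qed
  then show False using \<open>y \<noteq> z\<close> by (simp add: vec_eq_iff)
qed

lemma ball_subset_Q: "ball y (1 / (2 * real t)) \<subseteq> Q t y"
proof
  fix x assume x: "x \<in> ball y (1 / (2 * real t))"
  have "\<bar>x $ i - y $ i\<bar> \<le> dist y x" for i
    using component_le_norm_cart[of "x - y" i] by (simp add: dist_norm norm_minus_commute)
  also have "dist y x < 1 / (2 * real t)" using x unfolding mem_ball .
  finally show "x \<in> Q t y" unfolding Q_def by blast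
qed

text \<open>The balls are disjoint and lie in the cubes \<open>Q t y\<close>, hence in \<Omega>.
  Finite subsets \<open>F\<close> are used because the finiteness of \<open>X \<Omega> t\<close> is
  itself deduced from this bound.\<close>

lemma sum_emeasure_balls_le:
  assumes "open \<Omega>" "t > 0" "F \<subseteq> X \<Omega> t" "finite F"
  shows "(\<Sum>y\<in>F. emeasure lborel (ball y (1 / (2 * real t)))) \<le> emeasure lborel \<Omega>"
proof -
  have "(\<Sum>y\<in>F. emeasure lborel (ball y (1 / (2 * real t)))) = emeasure lborel (\<Union>y\<in>F. ball y (1 / (2 * real t)))"
  proof (rule sum_emeasure)
    show "disjoint_family_on (\<lambda>y. ball y (1 / (2 * real t))) F"
      unfolding disjoint_family_on_def
    proof (intro ballI impI)
      fix y z assume "y \<in> F" "z \<in> F" "y \<noteq> z"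
      then show "ball y (1 / (2 * real t)) \<inter> ball z (1 / (2 * real t)) = {}"
        using assms by (intro disjoint_balls_Y) (auto simp: X_def)
    qed
  qed (use assms in auto)
  also have "\<dots> \<le> emeasure lborel \<Omega>"
  proof (rule emeasure_mono)
    have "Q t y \<subseteq> \<Omega>" if "y \<in> F" for y using that assms by (auto simp: X_def)
    then show "(\<Union>y\<in>F. ball y (1 / (2 * real t))) \<subseteq> \<Omega>"
      using ball_subset_Q by (meson UN_least order_trans)
  qed (use assms in auto)
  finally show ?thesis .
qed

text \<open>Packing argument: all the balls have the same volume \<open>v > 0\<close>, so at most
  \<open>measure lborel \<Omega> / v\<close> of them fit into \<Omega>.\<close>

lemma finite_X:
  fixes \<Omega> :: "(real ^ 'n) set"
  assumes "open \<Omega>" "bounded \<Omega>" "t > 0"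
  shows "finite (X \<Omega> t)"
proof -
  define v where "v = unit_ball_vol CARD('n) * (1 / (2 * real t)) ^ CARD('n)"
  have v: "v > 0" using \<open>t > 0\<close> by (simp add: v_def)
  have fin: "emeasure lborel \<Omega> < \<infinity>" using assms emeasure_bounded_finite by blast
  have "card F \<le> nat \<lceil>measure lborel \<Omega> / v\<rceil>" if F: "F \<subseteq> X \<Omega> t" "finite F" for F
  proof -
    have "ennreal (card F * v) = (\<Sum>y\<in>F. emeasure lborel (ball y (1 / (2 * real t))))"
      using v by (simp add: emeasure_ball v_def ennreal_mult ennreal_of_nat_eq_real_of_nat)
    also have "\<dots> \<le> emeasure lborel \<Omega>" using assms F by (intro sum_emeasure_balls_le)
    also have "\<dots> = ennreal (measure lborel \<Omega>)" using fin by (simp add: emeasure_eq_ennreal_measure)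
    finally have "card F * v \<le> measure lborel \<Omega>" by (simp add: ennreal_le_iff)
    then have "card F \<le> measure lborel \<Omega> / v" using v by (simp add: field_simps)
    then show ?thesis by linarith
  qed
  then show ?thesis using finite_if_finite_subsets_card_bdd by blast
qed

section \<open>Pointwise bounds and measurability of \<open>nu\<close>\<close>

lemma nu_term_nonneg:
  assumes "\<sigma> \<in> K_class n"
  shows "0 \<le> \<sigma> (2 * real t * norm (x - y)) * indicat_real A x"
proof -
  have "0 < \<sigma> (2 * real t * norm (x - y))" using assms by (simp add: K_class_def)
  then show ?thesis by simp
qed

lemma nu_nonneg:
  assumes "\<sigma> \<in> K_class n"
  shows "0 \<le> nu \<Omega> \<sigma> t x"
proof -
  have "\<sigma> 1 > 0" using assms by (auto simp: K_class_def)
  then show ?thesis unfolding nu_def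
    by (intro add_nonneg_nonneg sum_nonneg nu_term_nonneg[OF assms]) (auto simp: indicator_def)
qed

text \<open>On \<open>G \<Omega> t\<close> the first summand of \<open>nu\<close> vanishes, and a
  sum of nonnegative terms dominates each of them.\<close>

lemma nu_ge_ball:
  assumes "\<sigma> \<in> K_class n" "finite (X \<Omega> t)" "y \<in> X \<Omega> t" "x \<in> ball y (1 / (2 * real t))"
  shows "\<sigma> (2 * real t * norm (x - y)) \<le> nu \<Omega> \<sigma> t x"
proof -
  have "x \<in> G \<Omega> t" using assms by (auto simp: G_def)
  then show ?thesis
    unfolding nu_def
    using member_le_sum[of y "X \<Omega> t" "\<lambda>y. \<sigma> (2 * real t * norm (x - y)) * indicat_real (ball y (1 / (2 * real t))) x"]
      assms nu_term_nonneg[OF assms(1)] by auto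
qed

lemma nu_ge_1:
  assumes "\<sigma> \<in> K_class n" "finite (X \<Omega> t)" "t > 0"
  shows "1 \<le> nu \<Omega> \<sigma> t x"
proof (cases "x \<in> G \<Omega> t")
  case True
  then obtain y where y: "y \<in> X \<Omega> t" "x \<in> ball y (1 / (2 * real t))" by (auto simp: G_def)
  then have "2 * real t * norm (x - y) \<in> {0..1}"
    using \<open>t > 0\<close> by (auto simp: dist_norm norm_minus_commute field_simps)
  then have "1 \<le> \<sigma> (2 * real t * norm (x - y))" using assms by (auto simp: K_class_def)
  then show ?thesis using nu_ge_ball[OF assms(1,2) y] by linarith
next
  case False
  have "1 \<le> \<sigma> 1" using assms by (auto simp: K_class_def)
  moreover have "\<sigma> 1 \<le> nu \<Omega> \<sigma> t x"
    unfolding nu_def using False by (auto intro!: sum_nonneg nu_term_nonneg[OF assms(1)])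
  ultimately show ?thesis by linarith
qed

text \<open>The values of \<open>\<sigma>\<close> at negative arguments are arbitrary, possibly not measurable.\<close>

lemma K_class_measurable:
  assumes "\<sigma> \<in> K_class n"
  shows "(\<lambda>\<rho>. \<sigma> \<bar>\<rho>\<bar>) \<in> borel_measurable borel"
proof -
  have s: "continuous_on {0<..} \<sigma>" using assms by (auto simp: K_class_def)
  have "continuous_on (- {0}) (\<lambda>\<rho>. \<sigma> \<bar>\<rho>\<bar>)"
    by (rule continuous_on_compose2[OF s]) (auto intro!: continuous_intros)
  \<comment> \<open>The point 0 is treated separately, since \<sigma> blows up there and is
    continuous only on \<open>{0<..}\<close>.\<close>
  then have "(\<lambda>\<rho>. if \<rho> \<in> {0} then \<sigma> 0 else \<sigma> \<bar>\<rho>\<bar>) \<in> borel_measurable borel"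
    by (intro borel_measurable_continuous_on_if) auto
  then show ?thesis by (rule measurable_cong[THEN iffD1, rotated]) auto
qed

lemma nu_measurable:
  assumes "\<sigma> \<in> K_class n" "finite (X \<Omega> t)"
  shows "nu \<Omega> \<sigma> t \<in> borel_measurable borel"
proof -
  note [measurable] = K_class_measurable[OF assms(1)]
  have G: "G \<Omega> t \<in> sets borel" unfolding G_def by (intro borel_open) auto
  have "(\<lambda>x. \<sigma> (2 * real t * norm (x - y)) * indicat_real (ball y (1 / (2 * real t))) x) \<in> borel_measurable borel" for y :: "real ^ 'a"
  proof -
    have [measurable]: "ball y (1 / (2 * real t)) \<in> sets borel" by simp
    \<comment> \<open>The argument is nonnegative, so the absolute value changes nothing and gives
      access to \<open>K_class_measurable\<close>.\<close>
    have "(\<lambda>x. \<sigma> \<bar>2 * real t * norm (x - y)\<bar> * indicat_real (ball y (1 / (2 * real t))) x) \<in> borel_measurable borel"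
      by measurable
    then show ?thesis by simp
  qed
  then show ?thesis unfolding nu_def using G by measurable
qed

section \<open>A bound for the integral of \<open>nu\<close> that is uniform in
  \<open>t\<close>\<close>

lemma nn_integral_nu_le:
  fixes \<Omega> :: "(real ^ 'n) set"
  assumes K: "\<sigma> \<in> K_class CARD('n)" and \<Omega>: "open \<Omega>" "bounded \<Omega>" and t: "t > 0"
  shows "(\<integral>\<^sup>+x. ennreal (nu \<Omega> \<sigma> t x) \<partial>lebesgue_on \<Omega>) \<le>
    (ennreal (\<sigma> 1) + (\<integral>\<^sup>+\<rho>. ennreal (\<sigma> \<rho> * (CARD('n) * \<rho> ^ (CARD('n) - 1))) * indicator {0..1} \<rho> \<partial>lborel)) *
      emeasure lborel \<Omega>"
proof -
  define r where "r = 1 / (2 * real t)"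
  define J where "J = (\<integral>\<^sup>+\<rho>. ennreal (\<sigma> \<rho> * (CARD('n) * \<rho> ^ (CARD('n) - 1))) * indicator {0..1} \<rho> \<partial>lborel)"
  note [measurable] = K_class_measurable[OF K]
  have r: "r > 0" using t by (simp add: r_def)
  have s1: "\<sigma> 1 > 0" and s0: "\<And>\<rho>. \<rho> \<ge> 0 \<Longrightarrow> \<sigma> \<rho> > 0" using K by (auto simp: K_class_def)
  have fin: "finite (X \<Omega> t)" using finite_X \<Omega> t by blast
  have [measurable]: "\<Omega> \<in> sets borel" using \<Omega> by auto
  have ball: "(\<integral>\<^sup>+x. ennreal (\<sigma> \<bar>norm (x - y) / r\<bar>) * indicator (ball y r) x \<partial>lborel) =
    emeasure lborel (ball y r) * J" for y :: "real ^ 'n"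
  proof -
    have "(\<integral>\<^sup>+\<rho>. ennreal (\<sigma> \<bar>\<rho>\<bar>) * ennreal (CARD('n) * \<rho> ^ (CARD('n) - 1)) * indicator {0..1} \<rho> \<partial>lborel) = J"
      unfolding J_def
    proof (rule nn_integral_cong)
      fix \<rho> :: real
      show "ennreal (\<sigma> \<bar>\<rho>\<bar>) * ennreal (CARD('n) * \<rho> ^ (CARD('n) - 1)) * indicator {0..1} \<rho> =
        ennreal (\<sigma> \<rho> * (CARD('n) * \<rho> ^ (CARD('n) - 1))) * indicator {0..1} \<rho>"
        using s0[of \<rho>] by (cases "\<rho> \<in> {0..1}") (auto simp: ennreal_mult[symmetric])
    qed
    then show ?thesis by (subst nn_integral_ball_radial[OF r]) auto
  qed
  have "(\<integral>\<^sup>+x. ennreal (nu \<Omega> \<sigma> t x) \<partial>lebesgue_on \<Omega>) = (\<integral>\<^sup>+x. ennreal (nu \<Omega> \<sigma> t x) * indicator \<Omega> x \<partial>lborel)"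
    using \<Omega> by (simp add: nn_integral_restrict_space nn_integral_completion)
  also have "\<dots> \<le> (\<integral>\<^sup>+x. ennreal (\<sigma> 1) * indicator \<Omega> x +
      (\<Sum>y\<in>X \<Omega> t. ennreal (\<sigma> \<bar>norm (x - y) / r\<bar>) * indicator (ball y r) x) \<partial>lborel)"
  proof (rule nn_integral_mono)
    fix x
    \<comment> \<open>The factor \<open>1 - indicat_real (G \<Omega> t) x\<close> is estimated by
      1.\<close>
    have "nu \<Omega> \<sigma> t x \<le> \<sigma> 1 + (\<Sum>y\<in>X \<Omega> t. \<sigma> \<bar>norm (x - y) / r\<bar> * indicator (ball y r) x)"
      unfolding nu_def r_def using s1 by (auto simp: indicator_def mult_ac)
    then have "ennreal (nu \<Omega> \<sigma> t x) \<le> ennreal (\<sigma> 1 + (\<Sum>y\<in>X \<Omega> t. \<sigma> \<bar>norm (x - y) / r\<bar> * indicator (ball y r) x))"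
      by (rule ennreal_leI)
    also have "\<dots> = ennreal (\<sigma> 1) + (\<Sum>y\<in>X \<Omega> t. ennreal (\<sigma> \<bar>norm (x - y) / r\<bar> * indicator (ball y r) x))"
      using s1 s0 by (subst ennreal_plus) (auto intro!: sum_nonneg simp: less_imp_le)
    also have "\<dots> = ennreal (\<sigma> 1) + (\<Sum>y\<in>X \<Omega> t. ennreal (\<sigma> \<bar>norm (x - y) / r\<bar>) * indicator (ball y r) x)"
      by (intro arg_cong2[where f="(+)"] sum.cong) (auto simp: indicator_def)
    finally show "ennreal (nu \<Omega> \<sigma> t x) * indicator \<Omega> x \<le> ennreal (\<sigma> 1) * indicator \<Omega> x +
        (\<Sum>y\<in>X \<Omega> t. ennreal (\<sigma> \<bar>norm (x - y) / r\<bar>) * indicator (ball y r) x)"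
      by (auto simp: indicator_def)
  qed
  also have "\<dots> = ennreal (\<sigma> 1) * emeasure lborel \<Omega> + (\<Sum>y\<in>X \<Omega> t. emeasure lborel (ball y r) * J)"
  proof -
    have [measurable]: "ball y r \<in> sets borel" for y :: "real ^ 'n" by simp
    show ?thesis by (subst nn_integral_add) (simp_all add: nn_integral_sum ball nn_integral_cmult del: abs_divide abs_norm_cancel)
  qed
  \<comment> \<open>Each ball contributes its volume times the same \<open>J\<close>, and the
    volumes add up to at most that of \<Omega>.\<close>
  also have "\<dots> \<le> ennreal (\<sigma> 1) * emeasure lborel \<Omega> + emeasure lborel \<Omega> * J"
    unfolding sum_distrib_right[symmetric] r_def
    by (intro add_left_mono mult_right_mono sum_emeasure_balls_le) (use \<Omega> t fin in auto)
  finally show ?thesis unfolding J_def by (simp add: algebra_simps)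
qed

section \<open>Grid cubes inside small balls\<close>

text \<open>Rounding \<open>t * z $ i\<close> down moves each coordinate by at most
  \<open>1 / t\<close>, and the cube adds \<open>1 / (2 * t)\<close>. The sum of the coordinate
  errors is thus at most \<open>CARD('n) * 3 / (2 * t)\<close>, which gives the threshold for
  \<open>t\<close>.\<close>

lemma grid_point_near:
  fixes z :: "real ^ 'n"
  assumes "e > 0" and t: "real t > 3 * CARD('n) / (2 * e)"
  shows "\<exists>y\<in>Y t. Q t y \<subseteq> ball z e"
proof
  have t0: "real t > 0" using assms by (smt (verit) divide_nonneg_pos of_nat_0_le_iff mult_nonneg_nonneg)
  define y :: "real ^ 'n" where "y = (\<chi> i. of_int \<lfloor>real t * z $ i\<rfloor> / real t)"
  show "y \<in> Y t" using t0 by (auto simp: Y_def y_def)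
  show "Q t y \<subseteq> ball z e"
  proof
    fix x assume x: "x \<in> Q t y"
    have "\<bar>(x - z) $ i\<bar> \<le> 3 / (2 * real t)" for i
    proof -
      have "\<bar>real t * z $ i - of_int \<lfloor>real t * z $ i\<rfloor>\<bar> \<le> 1" by linarith
      then have "\<bar>real t * (z $ i - y $ i)\<bar> \<le> 1" using t0 by (simp add: y_def right_diff_distrib)
      then have "\<bar>z $ i - y $ i\<bar> \<le> 1 / real t" using t0 by (simp add: abs_mult pos_le_divide_eq mult.commute)
      moreover have "\<bar>x $ i - y $ i\<bar> < 1 / (2 * real t)" using x by (auto simp: Q_def)
      ultimately have "\<bar>x $ i - z $ i\<bar> \<le> 1 / real t + 1 / (2 * real t)" by linarith
      also have "\<dots> = 3 / (2 * real t)" using t0 by (simp add: field_simps)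
      finally show ?thesis by simp
    qed
    then have "norm (x - z) \<le> (\<Sum>i\<in>(UNIV::'n set). 3 / (2 * real t))"
      by (intro order.trans[OF norm_le_l1_cart] sum_mono) auto
    also have "\<dots> < e" using t t0 \<open>e > 0\<close> by (simp add: field_simps)
    finally show "x \<in> ball z e" by (simp add: dist_norm norm_minus_commute)
  qed
qed

theorem theorem3p1:
  fixes \<Omega> :: "(real ^ 'n) set" and m :: nat and \<sigma> :: "real \<Rightarrow> real"
  assumes "CARD('n) \<ge> 2"
    and "open \<Omega>" and "connected \<Omega>" and "\<Omega> \<noteq> {}" and "bounded \<Omega>"
    and "m \<ge> 1" and "\<forall>t>m. X \<Omega> t \<noteq> {}"
    and "\<sigma> \<in> K_class CARD('n)"
  shows "\<exists>\<mu>\<in>M_class \<Omega>.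
    (AE x in lebesgue_on \<Omega>. (\<lambda>t. mu \<Omega> m \<sigma> t x) \<longlonglongrightarrow> \<mu> x) \<and>
    (\<forall>t\<ge>1. integrable (lebesgue_on \<Omega>) (mu \<Omega> m \<sigma> t)) \<and>
    (\<lambda>t. L1_norm \<Omega> (mu \<Omega> m \<sigma> t)) \<longlonglongrightarrow> L1_norm \<Omega> \<mu> \<and>
    (\<forall>t\<ge>1. AE x in lebesgue_on \<Omega>. mu \<Omega> m \<sigma> t x \<le> \<mu> x)"
proof -

  \<comment> \<open>Integrability of the terms and summability of their integrals\<close>
  note K = assms(8)
  let ?L = "lebesgue_on \<Omega>"
  have L\<Omega>: "\<Omega> \<in> sets lebesgue" using \<open>open \<Omega>\<close> by auto
  have fin: "finite (X \<Omega> (m + t))" for t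
    using finite_X[OF assms(2,5)] \<open>m \<ge> 1\<close> by simp
  define J where "J = (\<integral>\<^sup>+\<rho>. ennreal (\<sigma> \<rho> * (CARD('n) * \<rho> ^ (CARD('n) - 1))) * indicator {0..1} \<rho> \<partial>lborel)"
  have "J < \<infinity>"
  proof -
    have "set_integrable lborel {0..1} (\<lambda>\<rho>. \<sigma> \<rho> * \<rho> ^ (CARD('n) - 1))" using K by (simp add: K_class_def)
    then have "integrable lborel (\<lambda>\<rho>. real CARD('n) * (indicat_real {0..1} \<rho> * (\<sigma> \<rho> * \<rho> ^ (CARD('n) - 1))))"
      unfolding set_integrable_def real_scaleR_def by (rule integrable_mult_right)
    then have "(\<integral>\<^sup>+\<rho>. ennreal (norm (real CARD('n) * (indicat_real {0..1} \<rho> * (\<sigma> \<rho> * \<rho> ^ (CARD('n) - 1))))) \<partial>lborel) < \<infinity>"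
      unfolding integrable_iff_bounded by blast
    moreover have "J \<le> (\<integral>\<^sup>+\<rho>. ennreal (norm (real CARD('n) * (indicat_real {0..1} \<rho> * (\<sigma> \<rho> * \<rho> ^ (CARD('n) - 1))))) \<partial>lborel)"
      unfolding J_def by (intro nn_integral_mono) (auto simp: indicator_def mult_ac intro!: ennreal_leI)
    ultimately show ?thesis by simp
  qed
  define B where "B = enn2real ((ennreal (\<sigma> 1) + J) * emeasure lborel \<Omega>)"
  have B: "(ennreal (\<sigma> 1) + J) * emeasure lborel \<Omega> = ennreal B"
    unfolding B_def using \<open>J < \<infinity>\<close> emeasure_bounded_finite[OF assms(5)]
    by (simp add: ennreal_enn2real ennreal_mult_less_top)
  \<comment> \<open>The index is shifted so that the sum over \<open>1..t\<close> becomes the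
    partial sum over \<open>k < t\<close> of a series starting at 0.\<close>
  define f where "f k x = 1 / (real (Suc k))\<^sup>2 * nu \<Omega> \<sigma> (m + Suc k) x" for k x
  have f0: "0 \<le> f k x" for k x unfolding f_def by (intro mult_nonneg_nonneg nu_nonneg[OF K]) auto
  have mu: "mu \<Omega> m \<sigma> t x = (\<Sum>k<t. f k x)" for t x
    unfolding mu_def f_def by (simp only: One_nat_def sum.atLeast1_atMost_eq)
  have numeas: "nu \<Omega> \<sigma> (m + t) \<in> borel_measurable ?L" for t
    using nu_measurable[OF K fin] by (intro measurable_restrict_space1 measurable_completion) simp
  have nubd: "(\<integral>\<^sup>+x. ennreal (nu \<Omega> \<sigma> (m + t) x) \<partial>?L) \<le> ennreal B" for t
    using nn_integral_nu_le[OF K assms(2,5), of "m + t"] \<open>m \<ge> 1\<close> unfolding J_def[symmetric] B by simp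
  have nuint: "integrable ?L (nu \<Omega> \<sigma> (m + t))" for t
    using numeas nubd[of t] by (intro integrableI_nonneg) (auto simp: nu_nonneg[OF K] intro: le_less_trans)
  have nuint_le: "(\<integral>x. nu \<Omega> \<sigma> (m + t) x \<partial>?L) \<le> B" for t
  proof -
    have "ennreal (\<integral>x. nu \<Omega> \<sigma> (m + t) x \<partial>?L) \<le> ennreal B"
      using nubd[of t] nn_integral_eq_integral[OF nuint, of t] by (simp add: nu_nonneg[OF K])
    then show ?thesis by (simp add: B_def ennreal_le_iff)
  qed
  have fint: "integrable ?L (f k)" for k unfolding f_def by (intro integrable_mult_right nuint)
  have fint_le: "(\<integral>x. f k x \<partial>?L) \<le> B * (1 / (real (Suc k))\<^sup>2)" for k
    unfolding f_def using nuint_le[of "Suc k"] by (simp add: divide_right_mono)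
  have "summable (\<lambda>k. 1 / (real (Suc k))\<^sup>2)"
    using inverse_power_summable[of 2, where 'a = real] by (subst summable_Suc_iff) (simp add: field_simps)
  then have "summable (\<lambda>k. B * (1 / (real (Suc k))\<^sup>2))" by (rule summable_mult)
  then have fsum: "summable (\<lambda>k. \<integral>x. f k x \<partial>?L)"
  proof (rule summable_comparison_test'[where N = 0])
    show "norm (\<integral>x. f n x \<partial>?L) \<le> B * (1 / (real (Suc n))\<^sup>2)" for n
      using fint_le[of n] f0 by (simp add: integral_nonneg_AE)
  qed

  \<comment> \<open>The limit function and its integral\<close>
  have AEs: "AE x in ?L. summable (\<lambda>k. f k x)"
    using fint f0 fsum by (intro AE_summable_if_summable_integral)
  \<comment> \<open>A default value of at least 1 is needed: membership in \<open>M_class \<Omega>\<close> requires \<open>\<mu> x \<ge> 1\<close> for every \<open>x\<close> in \<open>\<Omega>\<close>.\<close>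
  define \<mu> where "\<mu> x = (if summable (\<lambda>k. f k x) then \<Sum>k. f k x else 1)" for x
  have AE\<mu>: "AE x in ?L. (\<Sum>k. f k x) = \<mu> x" using AEs by eventually_elim (simp add: \<mu>_def)
  have sint: "integrable ?L (\<lambda>x. \<Sum>k. f k x)"
    using fint AEs fsum f0 by (intro integrable_suminf) auto
  have sumsint: "(\<lambda>k. \<integral>x. f k x \<partial>?L) sums (\<integral>x. (\<Sum>k. f k x) \<partial>?L)"
    using fint AEs fsum f0 by (intro sums_integral) auto
  have \<mu>int: "integrable ?L \<mu> \<and> (\<integral>x. \<mu> x \<partial>?L) = (\<integral>x. (\<Sum>k. f k x) \<partial>?L)"
  proof -
    note [measurable] = borel_measurable_integrable[OF fint]
    \<comment> \<open>For real series summability is the Cauchy property of the partial sums, a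
      countable condition, so the case distinction in \<open>\<mu>\<close> is measurable.\<close>
    have "\<mu> \<in> borel_measurable ?L"
      unfolding \<mu>_def[abs_def] summable_iff_convergent Cauchy_convergent_iff[symmetric] by measurable
    then show ?thesis
      using integrable_cong_AE[OF _ _ AE\<mu>] integral_cong_AE[OF _ _ AE\<mu>] sint by auto
  qed
  have f_le: "f k x \<le> \<mu> x" if "summable (\<lambda>k. f k x)" for k x
    using sum_le_suminf[OF that, of "{k}"] f0 that by (simp add: \<mu>_def)
  have \<mu>1: "1 \<le> \<mu> x" for x
  proof (cases "summable (\<lambda>k. f k x)")
    case True
    \<comment> \<open>The first term has weight 1, so \<open>nu_ge_1\<close> carries over
      unchanged.\<close>
    have "1 \<le> f 0 x" using nu_ge_1[OF K fin, of 1 x] by (simp add: f_def)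
    then show ?thesis using f_le[OF True, of 0] by linarith
  qed (simp add: \<mu>_def)

  \<comment> \<open>Large values of the limit in every open set\<close>
  have large: "\<exists>H. H \<in> sets lebesgue \<and> H \<subseteq> U \<and> emeasure lebesgue H > 0 \<and> (\<forall>x\<in>H. \<mu> x \<ge> C)"
    if U: "open U" "U \<noteq> {}" "U \<subseteq> \<Omega>" and C: "C > 0" for U C
  proof -
    obtain z e where e: "e > 0" "ball z e \<subseteq> U" using U by (meson openE ex_in_conv)
    obtain k where k: "real k > 3 * CARD('n) / (2 * e)" using reals_Archimedean2 by blast
    define t where "t = m + Suc k"
    have t: "t > 0" "real t > 3 * CARD('n) / (2 * e)" using k by (auto simp: t_def)
    obtain y where y: "y \<in> Y t" "Q t y \<subseteq> ball z e" using grid_point_near[OF e(1) t(2)] by blast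
    have yX: "y \<in> X \<Omega> t" using y e U by (auto simp: X_def)
    \<comment> \<open>The factor \<open>(Suc k)\<close> squared compensates the weight of the single
      term \<open>f k\<close>, which alone pushes \<open>\<mu>\<close> above
      \<open>C\<close>.\<close>
    have "\<forall>\<^sub>F \<rho> in at_right 0. \<sigma> \<rho> \<ge> (real (Suc k))\<^sup>2 * C"
      using K by (auto simp: K_class_def filterlim_at_top)
    then obtain \<delta> where \<delta>: "\<delta> > 0" "\<And>\<rho>. 0 < \<rho> \<Longrightarrow> \<rho> < \<delta> \<Longrightarrow> \<sigma> \<rho> \<ge> (real (Suc k))\<^sup>2 * C"
      by (auto simp: eventually_at_right_field)
    \<comment> \<open>The bound by \<delta> makes \<sigma> large on the punctured ball; the bound by
      1 keeps it inside the ball belonging to \<open>y\<close>.\<close>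
    define s where "s = min \<delta> 1 / (2 * real t)"
    have s: "s > 0" "s \<le> 1 / (2 * real t)" "2 * real t * s \<le> \<delta>" using \<delta> t by (auto simp: s_def field_simps)
    \<comment> \<open>\<open>N\<close> covers the points of \<Omega> with a divergent series, where
      \<open>\<mu>\<close> has its default value 1 and need not dominate \<open>f k\<close>.\<close>
    obtain N where N: "N \<in> null_sets lebesgue" "\<And>x. x \<in> \<Omega> - N \<Longrightarrow> summable (\<lambda>k. f k x)"
    proof -
      have "AE x in lebesgue. x \<in> \<Omega> \<longrightarrow> summable (\<lambda>k. f k x)"
        using AEs L\<Omega> by (simp add: AE_restrict_space_iff)
      then obtain N where "N \<in> null_sets lebesgue"
        "\<And>x. x \<in> space lebesgue - N \<Longrightarrow> x \<in> \<Omega> \<longrightarrow> summable (\<lambda>k. f k x)"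
        by (rule AE_E3) blast
      then show ?thesis by (intro that) auto
    qed
    \<comment> \<open>The centre \<open>y\<close> is removed because \<open>\<sigma> 0\<close> need not be large.\<close>
    define H where "H = ball y s - (insert y N)"
    have ynull: "insert y N \<in> null_sets lebesgue"
      using N(1) negligible_insert negligible_iff_null_sets by blast
    have b: "ball y s \<subseteq> ball y (1 / (2 * real t))" using s by auto
    have HU: "H \<subseteq> U" unfolding H_def using b ball_subset_Q[of y t] y e by auto
    have "emeasure lebesgue H = emeasure lebesgue (ball y s)"
      unfolding H_def by (rule emeasure_Diff_null_set[OF ynull]) auto
    also have "\<dots> > 0" using s by (simp add: emeasure_ball)
    finally have pos: "emeasure lebesgue H > 0" .
    have "C \<le> \<mu> x" if x: "x \<in> H" for x
    proof -
      have xy: "x \<noteq> y" "norm (x - y) < s" using x by (auto simp: H_def dist_norm norm_minus_commute)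
      have "2 * real t * norm (x - y) < \<delta>" using xy s(3) t
        by (smt (verit) mult_strict_left_mono of_nat_0_less_iff)
      then have "(real (Suc k))\<^sup>2 * C \<le> \<sigma> (2 * real t * norm (x - y))"
        using xy t by (intro \<delta>) auto
      also have "\<dots> \<le> nu \<Omega> \<sigma> t x"
        using fin[of "Suc k"] x b by (intro nu_ge_ball[OF K _ yX]) (auto simp: t_def H_def)
      finally have "C \<le> f k x" by (simp add: f_def t_def field_simps)
      also have "\<dots> \<le> \<mu> x" using x HU \<open>U \<subseteq> \<Omega>\<close> by (intro f_le N(2)) (auto simp: H_def)
      finally show ?thesis .
    qed
    moreover have "H \<in> sets lebesgue" unfolding H_def using null_setsD2[OF ynull] by (intro sets.Diff) auto
    ultimately show ?thesis using HU pos by blast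
  qed

  \<comment> \<open>Norms of the partial sums and conclusion\<close>
  have muint: "integrable ?L (mu \<Omega> m \<sigma> t)" for t
    using fint by (simp add: mu[abs_def])
  have L1: "L1_norm \<Omega> (mu \<Omega> m \<sigma> t) = (\<Sum>k<t. \<integral>x. f k x \<partial>?L)" for t
    unfolding L1_norm_def mu using fint f0 by (simp add: sum_nonneg)
  have L1\<mu>: "L1_norm \<Omega> \<mu> = (\<integral>x. (\<Sum>k. f k x) \<partial>?L)"
    unfolding L1_norm_def using \<mu>1 \<mu>int by (simp add: order.trans[OF zero_le_one])
  show ?thesis
  proof (intro bexI[of _ \<mu>] conjI allI impI)
    show "\<mu> \<in> M_class \<Omega>" using \<mu>int \<mu>1 large by (auto simp: M_class_def)
    show "AE x in ?L. (\<lambda>t. mu \<Omega> m \<sigma> t x) \<longlonglongrightarrow> \<mu> x"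
      using AEs by eventually_elim (auto simp: mu \<mu>_def summable_LIMSEQ)
    show "integrable ?L (mu \<Omega> m \<sigma> t)" for t by (rule muint)
    \<comment> \<open>By nonnegativity the norms are the partial sums of the series of integrals,
      which converges to the integral of the sum.\<close>
    show "(\<lambda>t. L1_norm \<Omega> (mu \<Omega> m \<sigma> t)) \<longlonglongrightarrow> L1_norm \<Omega> \<mu>"
      using sumsint by (simp add: L1 L1\<mu> sums_def)
    show "AE x in ?L. mu \<Omega> m \<sigma> t x \<le> \<mu> x" for t
      using AEs by eventually_elim (auto simp: mu \<mu>_def f0 intro!: sum_le_suminf)
  qed
qed

end
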